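(* The billiard in the collared and transverse $\mathcal H$-ellipse has the following integrals $F_j$: $$F_j=\sum_{i\ne j}\frac{J_iJ_j(x_iy_j-x_jy_i)^2}{a_j-a_i}\qquad(j=0,1,2),$$ which satisfy the unique relation $$F_0+F_1+F_2=0,$$ where $-J_0=J_1=J_2=1$ is given by the signature of the metric in $\mathbf M^3$.
   Context: $\mathbf M^3$ is $\mathbb R^3$ with coordinates $(x_0,x_1,x_2)$ and the form $\langle x,y\rangle=-x_0y_0+x_1y_1+x_2y_2$; $\mathcal H=\{x:\langle x,x\rangle=1\}$ with the restricted Lorentz metric. Geodesics of $\mathcal H$ are given by intersections of $\mathcal H$ with planes through the origin. Let $A=\mathrm{diag}(a_0,a_1,a_2)$. The cone $\langle A^{-1}x,x\rangle=-\frac{x_0^2}{a_0}+\frac{x_1^2}{a_1}+\frac{x_2^2}{a_2}=0$ cuts $\mathcal H$ in boundary curves. If $0<a_0<a_1<a_2$ they are two closed curves, the collared $\mathcal H$-ellipse, bounding the compact domain $\{x\in\mathcal H:\langle A^{-1}x,x\rangle\ge0\}$. If $a_1<0<a_0<a_2$ they form the transverse $\mathcal H$-ellipse; of the two compact domains one takes $\{x\in\mathcal H:\langle A^{-1}x,x\rangle\ge0,\ x_2>0\}$. Billiard: the particle moves along geodesics of $\mathcal H$ inside the domain (a space-like segment being the length-minimizing arc); on hitting the boundary at $p$ its velocity $v\in T_p\mathcal H$ is decomposed as $v=t+n$, with $t$ tangent and $n$ normal (with respect to $\langle\cdot,\cdot\rangle$) to the boundary curve within $\mathcal H$, and becomes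 $t-n$; the motion stops if the normal is light-like. Successive reflection points are not antipodal. In $F_j$, $x_i$ and $y_i$ are the coordinates of vectors $x,y$ representing two successive reflection points. The vectors $x_k$ representing the successive reflection points of an orbit (rescalings of these points by positive factors) are chosen so that $|x_k\wedge x_{k+1}|^2=\langle x_k,x_{k+1}\rangle^2-\langle x_k,x_k\rangle\langle x_{k+1},x_{k+1}\rangle$ is constant in $k$. That $F_j$ is an integral means that its value on $(x_k,x_{k+1})$ does not depend on $k$.
   Formalization: For light-like orbits |x_k∧x_{k+1}|²=0 for every rescaling, so F_j need not be constant for an arbitrary choice; constancy is shown for all normalized choices when this constant is nonzero, and for some normalized choice on every orbit, light-like ones included. *)

theory Defs
  imports "HOL-Analysis.Analysis" "HOL-Computational_Algebra.Polynomial" "HOL-Library.Extended_Nat"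
begin

text \<open>Vectors of Lorentz 3-space are elements of \<open>real^3\<close>. The three elements of the index type
  \<open>3\<close> are written \<open>0\<close>, \<open>1\<close>, \<open>2\<close> (in this type \<open>3 = 0\<close>), so that \<open>x $ 0\<close> is the time coordinate.\<close>

definition lor :: "real^3 \<Rightarrow> real^3 \<Rightarrow> real" where
  "lor x y = - (x $ 0 * y $ 0) + x $ 1 * y $ 1 + x $ 2 * y $ 2"

definition hyp :: "(real^3) set" where
  "hyp = {x. lor x x = 1}"

text \<open>\<open>Ainv a x\<close> is the vector \<open>A\<^sup>-\<^sup>1 x\<close> for \<open>A = diag(a\<^sub>0, a\<^sub>1, a\<^sub>2)\<close>.\<close>

definition Ainv :: "real^3 \<Rightarrow> real^3 \<Rightarrow> real^3" where
  "Ainv a x = (\<chi> i. x $ i / a $ i)"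

definition collared :: "real^3 \<Rightarrow> bool" where
  "collared a \<longleftrightarrow> 0 < a $ 0 \<and> a $ 0 < a $ 1 \<and> a $ 1 < a $ 2"

definition transverse :: "real^3 \<Rightarrow> bool" where
  "transverse a \<longleftrightarrow> a $ 1 < 0 \<and> 0 < a $ 0 \<and> a $ 0 < a $ 2"

definition collared_domain :: "real^3 \<Rightarrow> (real^3) set" where
  "collared_domain a = {x \<in> hyp. lor (Ainv a x) x \<ge> 0}"

definition transverse_domain :: "real^3 \<Rightarrow> (real^3) set" where
  "transverse_domain a = {x \<in> hyp. lor (Ainv a x) x \<ge> 0 \<and> x $ 2 > 0}"

definition bdry :: "real^3 \<Rightarrow> (real^3) set \<Rightarrow> (real^3) set" where
  "bdry a D = {x \<in> D. lor (Ainv a x) x = 0}"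

definition tangent_hyp :: "real^3 \<Rightarrow> (real^3) set" where
  "tangent_hyp p = {v. lor p v = 0}"

text \<open>The boundary curve is cut out of \<open>hyp\<close> by \<open>lor (Ainv a x) x = 0\<close>, a quadratic form
  whose differential at \<open>p\<close> is \<open>2 * lor (Ainv a p) t\<close>.\<close>

definition tangent_bdry :: "real^3 \<Rightarrow> real^3 \<Rightarrow> (real^3) set" where
  "tangent_bdry a p = {t \<in> tangent_hyp p. lor (Ainv a p) t = 0}"

definition normal_bdry :: "real^3 \<Rightarrow> real^3 \<Rightarrow> (real^3) set" where
  "normal_bdry a p = {n \<in> tangent_hyp p. \<forall>t \<in> tangent_bdry a p. lor n t = 0}"

text \<open>The geodesic of \<open>hyp\<close> with initial point \<open>p\<close> and initial velocity \<open>v\<close>, parametrized with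
  constant \<open>lor\<close>-speed; it runs in the plane through the origin spanned by \<open>p\<close> and \<open>v\<close>.\<close>

definition geod :: "real^3 \<Rightarrow> real^3 \<Rightarrow> real \<Rightarrow> real^3" where
  "geod p v t =
     (if lor v v > 0 then
        cos (sqrt (lor v v) * t) *\<^sub>R p + (sin (sqrt (lor v v) * t) / sqrt (lor v v)) *\<^sub>R v
      else if lor v v < 0 then
        cosh (sqrt (- lor v v) * t) *\<^sub>R p + (sinh (sqrt (- lor v v) * t) / sqrt (- lor v v)) *\<^sub>R v
      else p + t *\<^sub>R v)"

text \<open>The incoming velocity \<open>w\<close> at the boundary point \<open>p\<close> is turned into \<open>v\<close>. If the normal
  is light-like, no \<open>v\<close> is admitted: the motion stops.\<close>

definition reflects :: "real^3 \<Rightarrow> real^3 \<Rightarrow> real^3 \<Rightarrow> real^3 \<Rightarrow> bool" where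
  "reflects a p w v \<longleftrightarrow>
     (\<forall>n \<in> normal_bdry a p. n \<noteq> 0 \<longrightarrow> lor n n \<noteq> 0) \<and>
     (\<exists>t \<in> tangent_bdry a p. \<exists>n \<in> normal_bdry a p. w = t + n \<and> v = t - n)"

text \<open>One flight from \<open>p\<close> with velocity \<open>v\<close>, lasting a time \<open>\<tau>\<close>, to the next boundary point \<open>q\<close>.
  The length of a space-like arc is \<open>sqrt (lor v v) * \<tau>\<close>, and the closed geodesic carrying it has
  length \<open>2 * pi\<close>; so the arc minimizes length iff its length is at most \<open>pi\<close>.\<close>

definition flight ::
    "real^3 \<Rightarrow> (real^3) set \<Rightarrow> real^3 \<Rightarrow> real^3 \<Rightarrow> real \<Rightarrow> real^3 \<Rightarrow> bool" where
  "flight a D p v \<tau> q \<longleftrightarrow>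
     p \<in> bdry a D \<and> q \<in> bdry a D \<and> q \<noteq> - p \<and>
     v \<in> tangent_hyp p \<and> v \<noteq> 0 \<and> 0 < \<tau> \<and> q = geod p v \<tau> \<and>
     (\<forall>t. 0 < t \<and> t < \<tau> \<longrightarrow> geod p v t \<in> D - bdry a D) \<and>
     (lor v v > 0 \<longrightarrow> sqrt (lor v v) * \<tau> \<le> pi)"

text \<open>An orbit of \<open>N\<close> flights, finite or infinite (it is finite if the motion stops):
  \<open>p k\<close> are the successive points on the boundary for \<open>k \<le> N\<close>, and \<open>v k\<close> is the velocity with which
  \<open>p k\<close> is left. The sequences are irrelevant beyond \<open>N\<close>.\<close>

definition billiard_orbit ::
    "real^3 \<Rightarrow> (real^3) set \<Rightarrow> enat \<Rightarrow> (nat \<Rightarrow> real^3) \<Rightarrow> (nat \<Rightarrow> real^3) \<Rightarrow> (nat \<Rightarrow> real) \<Rightarrow> bool" where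
  "billiard_orbit a D N p v \<tau> \<longleftrightarrow>
     (\<forall>k. enat k < N \<longrightarrow> flight a D (p k) (v k) (\<tau> k) (p (Suc k))) \<and>
     (\<forall>k. enat (Suc k) < N \<longrightarrow>
        reflects a (p (Suc k)) (vector_derivative (geod (p k) (v k)) (at (\<tau> k))) (v (Suc k)))"

definition wedge_sq :: "real^3 \<Rightarrow> real^3 \<Rightarrow> real" where
  "wedge_sq x y = (lor x y)\<^sup>2 - lor x x * lor y y"

text \<open>\<open>x k\<close> are positive multiples of the points \<open>p k\<close>, chosen so that \<open>wedge_sq\<close> takes the same
  value \<open>\<kappa>\<close> on all successive pairs. For a light-like orbit \<open>\<kappa> = 0\<close> whatever the multiples are.\<close>

definition normalized_rep ::
    "enat \<Rightarrow> (nat \<Rightarrow> real^3) \<Rightarrow> real \<Rightarrow> (nat \<Rightarrow> real^3) \<Rightarrow> bool" where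
  "normalized_rep N p \<kappa> x \<longleftrightarrow>
     (\<forall>k. enat k \<le> N \<longrightarrow> (\<exists>c>0. x k = c *\<^sub>R p k)) \<and>
     (\<forall>k. enat k < N \<longrightarrow> wedge_sq (x k) (x (Suc k)) = \<kappa>)"

definition successive_pairs :: "real^3 \<Rightarrow> (real^3) set \<Rightarrow> ((real^3) \<times> (real^3)) set" where
  "successive_pairs a D = {(x k, x (Suc k)) | N p v \<tau> \<kappa> x k.
     billiard_orbit a D N p v \<tau> \<and> normalized_rep N p \<kappa> x \<and> \<kappa> \<noteq> 0 \<and> enat k < N}"

definition J :: "3 \<Rightarrow> real" where
  "J i = (if i = 0 then - 1 else 1)"

definition F :: "real^3 \<Rightarrow> 3 \<Rightarrow> real^3 \<Rightarrow> real^3 \<Rightarrow> real" where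
  "F a j x y = (\<Sum>i \<in> UNIV - {j}. J i * J j * (x $ i * y $ j - x $ j * y $ i)\<^sup>2 / (a $ j - a $ i))"

text \<open>Polynomials in three variables are iterated univariate ones; \<open>X0\<close> is the innermost variable
  and \<open>X2\<close> the outermost one.\<close>

definition X0 :: "real poly poly poly" where "X0 = [:[:[:0, 1:]:]:]"
definition X1 :: "real poly poly poly" where "X1 = [:[:0, 1:]:]"
definition X2 :: "real poly poly poly" where "X2 = [:0, 1:]"

definition eval3 :: "real poly poly poly \<Rightarrow> real \<Rightarrow> real \<Rightarrow> real \<Rightarrow> real" where
  "eval3 P u0 u1 u2 = poly (poly (poly P [:[:u2:]:]) [:u1:]) u0"

end

theory Submission
  imports Defs
begin

text \<open>
  Each \<open>F a j\<close> is a quadratic form in the coordinates of the bivector \<open>x \<and> y\<close>, and so is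
  \<open>wedge_sq\<close>. For a point \<open>p\<close> moving along a geodesic with velocity \<open>v\<close>, the bivector \<open>p \<and> v\<close> is
  constant (it is the angular momentum of the motion), so every such form keeps its value during
  a flight (\<open>bivector_form_transport\<close>).

  At a reflection \<open>t + n\<close> is replaced by \<open>t - n\<close>. The form \<open>wedge_sq\<close> is unchanged because the
  speed is. For \<open>F a j\<close> one has to see that \<open>p \<and> t\<close> and \<open>p \<and> n\<close> are conjugate with respect to
  \<open>F a j\<close>. The normal is a multiple of \<open>Ainv a p\<close>, hence each coordinate of \<open>p \<and> n\<close> carries a factor
  \<open>a $ j - a $ i\<close> that cancels the denominator, and what remains is a combination of the numbers
  \<open>\<langle>Ainv a p, p\<rangle>\<close> and \<open>\<langle>Ainv a p, t\<rangle>\<close>, both of which vanish (\<open>F_reflect\<close>). So the values on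
  \<open>p k \<and> v k\<close> are the same for all \<open>k\<close>. Finally \<open>x k \<and> x (k + 1)\<close> is a scalar multiple of
  \<open>p k \<and> v k\<close>, and the normalization by \<open>wedge_sq\<close> makes the squares of these scalars equal.

  The relation holds because \<open>F a i\<close> and \<open>F a j\<close> contain the same square with opposite
  denominators. For its uniqueness it is enough that the values fill an open piece of
  the plane \<open>z\<^sub>0 + z\<^sub>1 + z\<^sub>2 = 0\<close>: a polynomial that vanishes there is divisible by the linear form
  (\<open>dvd_if_zero_on_open\<close>). Such a piece is already obtained from single flights along the time-like
  geodesics \<open>(sinh t, c cosh t, s cosh t)\<close>, which are symmetric in \<open>x\<^sub>0\<close>. There the only nonzero
  coordinates of \<open>x \<and> y\<close> are those with index \<open>0\<close>, in the ratio \<open>c : s\<close>, so that the direction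
  \<open>(c, s)\<close> together with a scaling of \<open>x\<close> produces any prescribed values of \<open>F a 1\<close> and \<open>F a 2\<close>
  in an open cone (\<open>vertical_values_attained\<close>).
\<close>

section \<open>Coordinates and the Lorentz form\<close>

lemma three_eq_zero: "(3 :: 3) = 0"
  by simp

lemma sum_UNIV_three: "sum f (UNIV :: 3 set) = f 0 + f 1 + f 2"
  by (simp add: sum_3 three_eq_zero add_ac)

lemma all_three: "(\<forall>i::3. P i) \<longleftrightarrow> P 0 \<and> P 1 \<and> P 2"
  using forall_3[of P] by (auto simp: three_eq_zero)

lemma vec_three_eq_iff: "(x :: real^3) = y \<longleftrightarrow> x $ 0 = y $ 0 \<and> x $ 1 = y $ 1 \<and> x $ 2 = y $ 2"
  by (simp add: vec_eq_iff all_three)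

lemma lor_eq_sum: "lor x y = (\<Sum>i\<in>UNIV. J i * x $ i * y $ i)"
  by (simp add: lor_def J_def sum_UNIV_three)

lemma lor_commute: "lor x y = lor y x"
  by (simp add: lor_def mult.commute)

lemma lor_add_left: "lor (x + y) z = lor x z + lor y z"
  and lor_add_right: "lor z (x + y) = lor z x + lor z y"
  and lor_diff_right: "lor z (x - y) = lor z x - lor z y"
  and lor_diff_left: "lor (x - y) z = lor x z - lor y z"
  by (simp_all add: lor_def algebra_simps)

lemmas lor_linear = lor_add_left lor_add_right lor_diff_left lor_diff_right

section \<open>Quadratic forms in the bivector of a pair\<close>

text \<open>A quadratic form in the coordinates of \<open>x \<and> y\<close> is multiplied by the square of the determinant
  when \<open>x, y\<close> are replaced by linear combinations of them. During a
  flight only this behaviour matters, and \<open>F a j\<close> and \<open>wedge_sq\<close> have it in common.\<close>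

definition bivector_form :: "(real^3 \<Rightarrow> real^3 \<Rightarrow> real) \<Rightarrow> bool" where
  "bivector_form Q \<longleftrightarrow> (\<forall>x y \<alpha> \<beta> \<gamma> \<delta>.
     Q (\<alpha> *\<^sub>R x + \<beta> *\<^sub>R y) (\<gamma> *\<^sub>R x + \<delta> *\<^sub>R y) = (\<alpha> * \<delta> - \<beta> * \<gamma>)\<^sup>2 * Q x y)"

lemma bivector_formD:
  "bivector_form Q \<Longrightarrow>
   Q (\<alpha> *\<^sub>R x + \<beta> *\<^sub>R y) (\<gamma> *\<^sub>R x + \<delta> *\<^sub>R y) = (\<alpha> * \<delta> - \<beta> * \<gamma>)\<^sup>2 * Q x y"
  by (simp add: bivector_form_def)

lemma bivector_form_F: "bivector_form (F a j)"
proof -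
  have "F a j (\<alpha> *\<^sub>R x + \<beta> *\<^sub>R y) (\<gamma> *\<^sub>R x + \<delta> *\<^sub>R y) = (\<alpha> * \<delta> - \<beta> * \<gamma>)\<^sup>2 * F a j x y"
    for x y \<alpha> \<beta> \<gamma> \<delta>
  proof -
    have minor: "((\<alpha> *\<^sub>R x + \<beta> *\<^sub>R y) $ i * (\<gamma> *\<^sub>R x + \<delta> *\<^sub>R y) $ j
          - (\<alpha> *\<^sub>R x + \<beta> *\<^sub>R y) $ j * (\<gamma> *\<^sub>R x + \<delta> *\<^sub>R y) $ i)\<^sup>2
        = (\<alpha> * \<delta> - \<beta> * \<gamma>)\<^sup>2 * (x $ i * y $ j - x $ j * y $ i)\<^sup>2" for i
      unfolding power_mult_distrib[symmetric]
      by (rule arg_cong[where f = "\<lambda>r. r\<^sup>2"]) (simp add: algebra_simps)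
    show ?thesis
      unfolding F_def minor sum_distrib_left by (rule sum.cong) (simp_all add: algebra_simps)
  qed
  then show ?thesis by (simp add: bivector_form_def)
qed

lemma bivector_form_wedge_sq: "bivector_form wedge_sq"
  unfolding bivector_form_def wedge_sq_def
  by (simp add: lor_def power2_eq_square algebra_simps)

text \<open>The square with indices \<open>i, j\<close> enters \<open>F a i\<close> and \<open>F a j\<close> with denominators that
  differ in sign only.\<close>

lemma F_sum_zero: "F a 0 x y + F a 1 x y + F a 2 x y = 0"
proof -
  have cancel: "s * u\<^sup>2 / (b - c) + s * (- u)\<^sup>2 / (c - b) = 0" for s u b c :: real
    by (cases "b = c") (simp_all add: divide_simps algebra_simps)
  have U: "UNIV - {0} = {1, 2 :: 3}" "UNIV - {1} = {0, 2 :: 3}" "UNIV - {2} = {0, 1 :: 3}"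
    using all_three[of "\<lambda>i. i = 0 \<or> i = 1 \<or> i = 2"] by auto
  show ?thesis
    using cancel[of "-1" "x $ 1 * y $ 0 - x $ 0 * y $ 1" "a $ 0" "a $ 1"]
      cancel[of "-1" "x $ 2 * y $ 0 - x $ 0 * y $ 2" "a $ 0" "a $ 2"]
      cancel[of "1" "x $ 2 * y $ 1 - x $ 1 * y $ 2" "a $ 1" "a $ 2"]
    by (simp add: F_def U J_def)
qed

section \<open>Flights\<close>

text \<open>The three formulas for geodesics are the solutions of \<open>p'' = - e p\<close>, where \<open>e = lor v v\<close>.
  With \<open>geod_cos e\<close> and \<open>geod_sin e\<close>, the solutions with initial data \<open>(1, 0)\<close> and \<open>(0, 1)\<close>,
  the space-like, time-like and light-like cases are treated at once.\<close>

definition geod_cos :: "real \<Rightarrow> real \<Rightarrow> real" where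
  "geod_cos e t = (if e > 0 then cos (sqrt e * t) else if e < 0 then cosh (sqrt (- e) * t) else 1)"

definition geod_sin :: "real \<Rightarrow> real \<Rightarrow> real" where
  "geod_sin e t = (if e > 0 then sin (sqrt e * t) / sqrt e
     else if e < 0 then sinh (sqrt (- e) * t) / sqrt (- e) else t)"

lemma geod_eq: "geod p v t = geod_cos (lor v v) t *\<^sub>R p + geod_sin (lor v v) t *\<^sub>R v"
  by (simp add: geod_def geod_cos_def geod_sin_def)

lemma geod_cos_sin: "(geod_cos e t)\<^sup>2 + e * (geod_sin e t)\<^sup>2 = 1"
  using cosh_square_eq[of "sqrt (- e) * t"]
  by (auto simp: geod_cos_def geod_sin_def power_divide field_simps)

lemma geod_cos_deriv: "(geod_cos e has_real_derivative - e * geod_sin e t) (at t)"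
proof -
  consider "e > 0" | "e < 0" | "e = 0" by linarith
  then show ?thesis
  proof cases
    case 1
    then have "geod_cos e = (\<lambda>t. cos (sqrt e * t))" by (simp add: geod_cos_def fun_eq_iff)
    moreover have "((\<lambda>t. cos (sqrt e * t)) has_real_derivative - e * (sin (sqrt e * t) / sqrt e)) (at t)"
      using 1 by (auto intro!: derivative_eq_intros simp: field_simps)
    ultimately show ?thesis using 1 by (simp add: geod_sin_def)
  next
    case 2
    then have sq: "sqrt (- e) * (sqrt (- e) * x) = - e * x" for x
      by (simp flip: mult.assoc)
    from 2 have "geod_cos e = (\<lambda>t. cosh (sqrt (- e) * t))" by (simp add: geod_cos_def fun_eq_iff)
    moreover have "((\<lambda>t. cosh (sqrt (- e) * t)) has_real_derivative
        - e * (sinh (sqrt (- e) * t) / sqrt (- e))) (at t)"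
      using 2 by (auto intro!: derivative_eq_intros simp: field_simps sq)
    ultimately show ?thesis using 2 by (simp add: geod_sin_def)
  next
    case 3
    then have "geod_cos e = (\<lambda>t. 1)" by (simp add: geod_cos_def fun_eq_iff)
    with 3 show ?thesis by simp
  qed
qed

lemma geod_sin_deriv: "(geod_sin e has_real_derivative geod_cos e t) (at t)"
proof -
  consider "e > 0" | "e < 0" | "e = 0" by linarith
  then show ?thesis
  proof cases
    case 1
    have "((\<lambda>t. sin (sqrt e * t) / sqrt e) has_real_derivative
        cos (sqrt e * t) * sqrt e / sqrt e) (at t)"
      by (rule DERIV_cdivide) (auto intro!: derivative_eq_intros)
    moreover have "geod_sin e = (\<lambda>t. sin (sqrt e * t) / sqrt e)"
      using 1 by (simp add: geod_sin_def fun_eq_iff)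
    moreover have "cos (sqrt e * t) * sqrt e / sqrt e = geod_cos e t"
      using 1 by (simp add: geod_cos_def)
    ultimately show ?thesis by metis
  next
    case 2
    have "((\<lambda>t. sinh (sqrt (- e) * t) / sqrt (- e)) has_real_derivative
        cosh (sqrt (- e) * t) * sqrt (- e) / sqrt (- e)) (at t)"
      by (rule DERIV_cdivide) (auto intro!: derivative_eq_intros)
    moreover have "geod_sin e = (\<lambda>t. sinh (sqrt (- e) * t) / sqrt (- e))"
      using 2 by (simp add: geod_sin_def fun_eq_iff)
    moreover have "cosh (sqrt (- e) * t) * sqrt (- e) / sqrt (- e) = geod_cos e t"
      using 2 by (simp add: geod_cos_def)
    ultimately show ?thesis by metis
  next
    case 3
    then have "geod_sin e = (\<lambda>t. t)" by (simp add: geod_sin_def fun_eq_iff)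
    moreover have "geod_cos e t = 1" using 3 by (simp add: geod_cos_def)
    ultimately show ?thesis by (metis DERIV_ident)
  qed
qed

lemma geod_velocity:
  "vector_derivative (geod p v) (at t)
     = (- lor v v * geod_sin (lor v v) t) *\<^sub>R p + geod_cos (lor v v) t *\<^sub>R v"
proof (rule vector_derivative_at)
  have eq: "geod p v = (\<lambda>t. geod_cos (lor v v) t *\<^sub>R p + geod_sin (lor v v) t *\<^sub>R v)"
    by (simp add: geod_eq fun_eq_iff)
  show "(geod p v has_vector_derivative
      (- lor v v * geod_sin (lor v v) t) *\<^sub>R p + geod_cos (lor v v) t *\<^sub>R v) (at t)"
    unfolding eq
    by (auto intro!: derivative_eq_intros geod_cos_deriv geod_sin_deriv)
qed

text \<open>Position and velocity at time \<open>t\<close> arise from \<open>p, v\<close> by a linear map that, by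
  \<open>geod_cos_sin\<close>, has determinant \<open>1\<close>.\<close>

lemma bivector_form_transport:
  assumes "bivector_form Q"
  shows "Q (geod p v t) (vector_derivative (geod p v) (at t)) = Q p v"
proof -
  let ?c = "geod_cos (lor v v) t" and ?s = "geod_sin (lor v v) t"
  have "?c * ?c - ?s * (- lor v v * ?s) = 1"
    using geod_cos_sin[of "lor v v" t] by (simp add: power2_eq_square algebra_simps)
  then show ?thesis
    unfolding geod_velocity geod_eq bivector_formD[OF assms] by simp
qed

lemma bivector_form_chord:
  assumes "bivector_form Q"
  shows "Q (c *\<^sub>R p) (d *\<^sub>R geod p v t) = (c * d * geod_sin (lor v v) t)\<^sup>2 * Q p v"
  using bivector_formD[OF assms, of c p 0 v "d * geod_cos (lor v v) t" "d * geod_sin (lor v v) t"]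
  by (simp add: geod_eq scaleR_add_right mult.assoc)

section \<open>Reflections\<close>

text \<open>In the orthogonal complement of \<open>p\<close>, a plane, the tangent of the boundary is the vector
  orthogonal to \<open>Ainv a p\<close>; the normal, being orthogonal to it in turn, lies on the line of \<open>Ainv a p\<close>.
  This also holds if that line is light-like.\<close>

lemma normal_bdry_parallel:
  assumes p: "lor p p = 1" and bd: "lor (Ainv a p) p = 0" and n: "n \<in> normal_bdry a p"
    and nz: "Ainv a p \<noteq> 0"
  shows "\<exists>s. n = s *\<^sub>R Ainv a p"
proof -
  define b where "b = Ainv a p"
  have bp: "lor b p = 0" using bd by (simp add: b_def)
  \<comment> \<open>the Lorentz cross product of \<open>p\<close> and \<open>b\<close>, which spans the tangent line\<close>
  define t :: "real^3" where "t = (\<chi> i. if i = 0 then - (p $ 1 * b $ 2 - p $ 2 * b $ 1)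
     else if i = 1 then p $ 2 * b $ 0 - p $ 0 * b $ 2 else p $ 0 * b $ 1 - p $ 1 * b $ 0)"
  have t: "t $ 0 = - (p $ 1 * b $ 2 - p $ 2 * b $ 1)" "t $ 1 = p $ 2 * b $ 0 - p $ 0 * b $ 2"
    "t $ 2 = p $ 0 * b $ 1 - p $ 1 * b $ 0" by (simp_all add: t_def)
  have "lor p t = 0" "lor b t = 0" by (simp_all add: lor_def t algebra_simps)
  then have "lor n t = 0" "lor p n = 0"
    using n by (auto simp: normal_bdry_def tangent_bdry_def tangent_hyp_def b_def)
  then have det: "- (n $ 0 * - (p $ 1 * b $ 2 - p $ 2 * b $ 1)) + n $ 1 * (p $ 2 * b $ 0 - p $ 0 * b $ 2)
      + n $ 2 * (p $ 0 * b $ 1 - p $ 1 * b $ 0) = 0"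
    and pn: "- (p $ 0 * n $ 0) + p $ 1 * n $ 1 + p $ 2 * n $ 2 = 0"
    by (simp_all add: lor_def t)
  have pb: "- (p $ 0 * b $ 0) + p $ 1 * b $ 1 + p $ 2 * b $ 2 = 0"
    using bp by (simp add: lor_def algebra_simps)
  have pp: "- (p $ 0 * p $ 0) + p $ 1 * p $ 1 + p $ 2 * p $ 2 = 1"
    using p by (simp add: lor_def)
  have par: "b $ 0 * n $ 1 = b $ 1 * n $ 0" "b $ 0 * n $ 2 = b $ 2 * n $ 0"
      "b $ 1 * n $ 2 = b $ 2 * n $ 1"
    using det pn pb pp by algebra+
  from nz obtain k where k: "b $ k \<noteq> 0" by (auto simp: vec_eq_iff b_def)
  have "\<forall>k i. b $ k * n $ i = b $ i * n $ k"
    using par by (simp add: all_three)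
  then have "n $ i = ((n $ k / b $ k) *\<^sub>R b) $ i" for i
    using k by (simp add: field_simps)
  then have "n = (n $ k / b $ k) *\<^sub>R b" unfolding vec_eq_iff by blast
  then show ?thesis by (auto simp: b_def)
qed

text \<open>The bivectors \<open>p \<and> t\<close> and \<open>p \<and> Ainv a p\<close> are conjugate with respect to \<open>F a j\<close>: the coordinate
  \<open>i, j\<close> of the second one is a multiple of \<open>(a $ j - a $ i) p\<^sub>i p\<^sub>j / (a\<^sub>i a\<^sub>j)\<close>, so the denominators of
  \<open>F a j\<close> cancel and its polar form becomes a sum of multiples of \<open>lor (Ainv a p) p\<close> and
  \<open>lor (Ainv a p) t\<close>.\<close>

lemma F_reflect:
  assumes a: "\<And>i. a $ i \<noteq> 0" "\<And>i j. i \<noteq> j \<Longrightarrow> a $ i \<noteq> a $ j"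
    and p: "lor (Ainv a p) p = 0" and t: "lor (Ainv a p) t = 0"
  shows "F a j p (t + s *\<^sub>R Ainv a p) = F a j p (t - s *\<^sub>R Ainv a p)"
proof -
  let ?n = "s *\<^sub>R Ainv a p"
  have term_diff: "J i * J j * (p $ i * (t + ?n) $ j - p $ j * (t + ?n) $ i)\<^sup>2 / (a $ j - a $ i)
      - J i * J j * (p $ i * (t - ?n) $ j - p $ j * (t - ?n) $ i)\<^sup>2 / (a $ j - a $ i)
    = - (4 * s * J j * p $ j / a $ j) * (J i * p $ i / a $ i * (p $ i * t $ j - p $ j * t $ i))"
    if "i \<noteq> j" for i
  proof -
    have "J i * J j * (p $ i * (t + ?n) $ j - p $ j * (t + ?n) $ i)\<^sup>2
        - J i * J j * (p $ i * (t - ?n) $ j - p $ j * (t - ?n) $ i)\<^sup>2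
      = 4 * (J i * J j * (p $ i * t $ j - p $ j * t $ i) * (p $ i * ?n $ j - p $ j * ?n $ i))"
      by (simp add: algebra_simps power2_eq_square)
    also have "p $ i * ?n $ j - p $ j * ?n $ i
        = - (s * p $ i * p $ j / (a $ i * a $ j)) * (a $ j - a $ i)"
      using a(1)[of i] a(1)[of j] by (simp add: Ainv_def field_simps)
    finally have diff: "J i * J j * (p $ i * (t + ?n) $ j - p $ j * (t + ?n) $ i)\<^sup>2
        - J i * J j * (p $ i * (t - ?n) $ j - p $ j * (t - ?n) $ i)\<^sup>2
      = - (4 * s * J j * p $ j / a $ j) * (J i * p $ i / a $ i * (p $ i * t $ j - p $ j * t $ i))
        * (a $ j - a $ i)"
      by (simp add: mult_ac)
    show ?thesis
      unfolding diff_divide_distrib[symmetric] diff using a(2)[OF that] by simp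
  qed
  have "F a j p (t + ?n) - F a j p (t - ?n)
      = (\<Sum>i\<in>UNIV - {j}. - (4 * s * J j * p $ j / a $ j)
           * (J i * p $ i / a $ i * (p $ i * t $ j - p $ j * t $ i)))"
    unfolding F_def sum_subtractf[symmetric] by (intro sum.cong refl term_diff) blast
  also have "\<dots> = (\<Sum>i\<in>UNIV. - (4 * s * J j * p $ j / a $ j)
           * (J i * p $ i / a $ i * (p $ i * t $ j - p $ j * t $ i)))"
    \<comment> \<open>the summand with \<open>i = j\<close> is zero now that the denominators are gone\<close>
    by (rule sum.mono_neutral_left) auto
  also have "\<dots> = - (4 * s * J j * p $ j / a $ j)
           * (t $ j * lor (Ainv a p) p - p $ j * lor (Ainv a p) t)"
    unfolding lor_eq_sum sum_distrib_left sum_subtractf[symmetric]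
    by (rule sum.cong) (simp_all add: Ainv_def algebra_simps)
  finally show ?thesis by (simp add: p t)
qed

lemma wedge_sq_reflect:
  assumes "lor p t = 0" "lor p n = 0" "lor n t = 0"
  shows "wedge_sq p (t + n) = wedge_sq p (t - n)"
  using assms by (simp add: wedge_sq_def lor_linear lor_commute[of t n])

lemma reflects_preserves:
  assumes a: "\<And>i. a $ i \<noteq> 0" "\<And>i j. i \<noteq> j \<Longrightarrow> a $ i \<noteq> a $ j"
    and p: "lor p p = 1" "lor (Ainv a p) p = 0" and r: "reflects a p w v"
  shows "F a j p w = F a j p v" "wedge_sq p w = wedge_sq p v"
proof -
  obtain t n where t: "t \<in> tangent_bdry a p" and n: "n \<in> normal_bdry a p"
    and wv: "w = t + n" "v = t - n"
    using r by (auto simp: reflects_def)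
  have "p \<noteq> 0" using p(1) by (auto simp: lor_def)
  then have "Ainv a p \<noteq> 0" using a(1) by (auto simp: Ainv_def vec_eq_iff)
  then obtain s where "n = s *\<^sub>R Ainv a p"
    using normal_bdry_parallel[OF p n] by blast
  then show "F a j p w = F a j p v"
    using F_reflect[OF a p(2)] t by (simp add: wv tangent_bdry_def)
  show "wedge_sq p w = wedge_sq p v"
    using t n unfolding wv
    by (intro wedge_sq_reflect) (auto simp: tangent_bdry_def normal_bdry_def tangent_hyp_def)
qed

lemma wedge_sq_tangent: "lor p p = 1 \<Longrightarrow> lor p v = 0 \<Longrightarrow> wedge_sq p v = - lor v v"
  by (simp add: wedge_sq_def)

text \<open>The bivector \<open>p \<and> q\<close> of the chord is \<open>geod_sin\<close> times \<open>p \<and> v\<close>. On a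
  space-like arc of length at most \<open>pi\<close> this factor could vanish at length \<open>pi\<close> only, where the end
  points are antipodal.\<close>

lemma flight_geod_sin_nonzero:
  assumes "flight a D p v \<tau> q"
  shows "geod_sin (lor v v) \<tau> \<noteq> 0"
proof -
  let ?e = "lor v v"
  have \<tau>: "0 < \<tau>" and q: "q = geod p v \<tau>" "q \<noteq> - p"
    and short: "?e > 0 \<Longrightarrow> sqrt ?e * \<tau> \<le> pi"
    using assms by (auto simp: flight_def)
  show ?thesis
  proof (cases "?e > 0")
    case True
    have "sqrt ?e * \<tau> \<noteq> pi"
      using q True by (auto simp: geod_eq geod_cos_def geod_sin_def)
    then have "0 < sin (sqrt ?e * \<tau>)"
      using True \<tau> short by (intro sin_gt_zero) auto
    then show ?thesis using True by (simp add: geod_sin_def)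
  next
    case False
    then show ?thesis using \<tau> by (auto simp: geod_sin_def)
  qed
qed

section \<open>The integrals\<close>

lemma billiard_orbit_conserved:
  assumes orbit: "billiard_orbit a D N p v \<tau>" and D: "D \<subseteq> hyp"
    and Q: "bivector_form Q"
    and reflect: "\<And>p w v. lor p p = 1 \<Longrightarrow> lor (Ainv a p) p = 0 \<Longrightarrow> reflects a p w v \<Longrightarrow> Q p w = Q p v"
    and k: "enat k < N"
  shows "Q (p k) (v k) = Q (p 0) (v 0)"
  using k
proof (induction k)
  case (Suc k)
  have "enat k < N" using Suc.prems by (meson enat_ord_simps(2) lessI order_less_trans)
  then have fl: "flight a D (p k) (v k) (\<tau> k) (p (Suc k))"
    using orbit by (simp add: billiard_orbit_def)
  then have q: "p (Suc k) = geod (p k) (v k) (\<tau> k)"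
    unfolding flight_def by blast
  from fl have "p (Suc k) \<in> bdry a D"
    unfolding flight_def by blast
  then have "lor (p (Suc k)) (p (Suc k)) = 1" "lor (Ainv a (p (Suc k))) (p (Suc k)) = 0"
    using D by (auto simp: bdry_def hyp_def)
  moreover have "reflects a (p (Suc k)) (vector_derivative (geod (p k) (v k)) (at (\<tau> k))) (v (Suc k))"
    using orbit Suc.prems by (simp add: billiard_orbit_def)
  ultimately have "Q (p (Suc k)) (v (Suc k))
      = Q (p (Suc k)) (vector_derivative (geod (p k) (v k)) (at (\<tau> k)))"
    by (metis reflect)
  also have "\<dots> = Q (p k) (v k)"
    unfolding q by (rule bivector_form_transport[OF Q])
  also have "\<dots> = Q (p 0) (v 0)" using \<open>enat k < N\<close> by (rule Suc.IH)
  finally show ?case .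
qed simp

locale billiard =
  fixes a :: "real^3" and D :: "(real^3) set"
  assumes a_nonzero: "a $ i \<noteq> 0"
    and a_distinct: "i \<noteq> j \<Longrightarrow> a $ i \<noteq> a $ j"
    and D_subset: "D \<subseteq> hyp"
begin

lemma chord_value:
  assumes orbit: "billiard_orbit a D N p v \<tau>" and k: "enat k < N"
    and x: "x k = c *\<^sub>R p k" "x (Suc k) = d *\<^sub>R p (Suc k)"
  shows "F a j (x k) (x (Suc k)) = (c * d * geod_sin (lor (v k) (v k)) (\<tau> k))\<^sup>2 * F a j (p 0) (v 0)"
    and "wedge_sq (x k) (x (Suc k))
      = (c * d * geod_sin (lor (v k) (v k)) (\<tau> k))\<^sup>2 * wedge_sq (p 0) (v 0)"
proof -
  have q: "p (Suc k) = geod (p k) (v k) (\<tau> k)"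
    using orbit k unfolding billiard_orbit_def flight_def by blast
  note pres = reflects_preserves[OF a_nonzero a_distinct]
  note cons = billiard_orbit_conserved[OF orbit D_subset _ _ k]
  have "F a j (p k) (v k) = F a j (p 0) (v 0)"
    by (rule cons[OF bivector_form_F pres(1)])
  then show "F a j (x k) (x (Suc k))
      = (c * d * geod_sin (lor (v k) (v k)) (\<tau> k))\<^sup>2 * F a j (p 0) (v 0)"
    unfolding x q by (simp add: bivector_form_chord[OF bivector_form_F])
  have "wedge_sq (p k) (v k) = wedge_sq (p 0) (v 0)"
    by (rule cons[OF bivector_form_wedge_sq pres(2)])
  then show "wedge_sq (x k) (x (Suc k))
      = (c * d * geod_sin (lor (v k) (v k)) (\<tau> k))\<^sup>2 * wedge_sq (p 0) (v 0)"
    unfolding x q by (simp add: bivector_form_chord[OF bivector_form_wedge_sq])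
qed

text \<open>By \<open>chord_value\<close>, \<open>F a j\<close> and \<open>wedge_sq\<close> take on \<open>x k, x (Suc k)\<close> their conserved values times
  the same factor; a prescribed nonzero value \<open>\<kappa>\<close> of \<open>wedge_sq\<close> determines this factor.\<close>

lemma integral_if_normalized:
  assumes orbit: "billiard_orbit a D N p v \<tau>" and x: "normalized_rep N p \<kappa> x" and \<kappa>: "\<kappa> \<noteq> 0"
    and k: "enat k < N"
  shows "F a j (x k) (x (Suc k)) = \<kappa> / wedge_sq (p 0) (v 0) * F a j (p 0) (v 0)"
proof -
  have "enat k \<le> N" "enat (Suc k) \<le> N"
    using k by (simp_all add: Suc_ile_eq)
  then obtain c d where c: "x k = c *\<^sub>R p k" and d: "x (Suc k) = d *\<^sub>R p (Suc k)"
    using x by (meson normalized_rep_def)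
  let ?m = "(c * d * geod_sin (lor (v k) (v k)) (\<tau> k))\<^sup>2"
  have "?m * wedge_sq (p 0) (v 0) = \<kappa>"
    using chord_value(2)[where x = x, OF orbit k c d] x k by (simp add: normalized_rep_def)
  then have "?m = \<kappa> / wedge_sq (p 0) (v 0)" using \<kappa> by (auto simp: field_simps)
  with chord_value(1)[where x = x, OF orbit k c d] show ?thesis by simp
qed

text \<open>The scalars \<open>c k\<close> are chosen successively so that \<open>c k * c (Suc k) * s k = \<plusminus>1\<close>, where \<open>s k\<close> is the
  factor by which the chord bivector differs from \<open>p k \<and> v k\<close>. This choice does not refer
  to the value of \<open>wedge_sq\<close>, so it also serves for light-like orbits.\<close>

lemma exists_normalization:
  assumes orbit: "billiard_orbit a D N p v \<tau>"
  shows "\<exists>\<kappa> x. normalized_rep N p \<kappa> x \<and>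
    (\<forall>j k. enat k < N \<longrightarrow> F a j (x k) (x (Suc k)) = F a j (p 0) (v 0))"
proof -
  define s where "s k = geod_sin (lor (v k) (v k)) (\<tau> k)" for k
  \<comment> \<open>the value for \<open>s k = 0\<close>, possible only beyond the end of the orbit, keeps \<open>c\<close> positive\<close>
  define c where "c = rec_nat (1::real) (\<lambda>k r. if s k = 0 then 1 else 1 / (r * \<bar>s k\<bar>))"
  define x where "x k = c k *\<^sub>R p k" for k
  have c0: "c 0 = 1" and cSuc: "c (Suc k) = (if s k = 0 then 1 else 1 / (c k * \<bar>s k\<bar>))" for k
    by (simp_all add: c_def)
  have c_pos: "c k > 0" for k by (induction k) (simp_all add: c0 cSuc)
  have unit: "(c k * c (Suc k) * s k)\<^sup>2 = 1" if "enat k < N" for k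
  proof -
    have "s k \<noteq> 0"
      using orbit that flight_geod_sin_nonzero unfolding billiard_orbit_def s_def by blast
    then have "(c k * c (Suc k) * s k)\<^sup>2 = (s k / \<bar>s k\<bar>)\<^sup>2"
      using c_pos[of k] by (simp add: cSuc)
    also have "\<dots> = 1" using \<open>s k \<noteq> 0\<close> by (simp add: power_divide)
    finally show ?thesis .
  qed
  have "normalized_rep N p (wedge_sq (p 0) (v 0)) x"
    using c_pos unit chord_value(2)[OF orbit _ x_def x_def] unfolding normalized_rep_def s_def
    by (auto simp: x_def)
  moreover have "F a j (x k) (x (Suc k)) = F a j (p 0) (v 0)" if "enat k < N" for j k
    using unit[OF that] chord_value(1)[OF orbit that x_def x_def] by (simp add: s_def)
  ultimately show ?thesis by blast
qed

end

section \<open>Polynomials vanishing on an open part of the plane\<close>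

lemma poly_eq_zero_if_infinite_roots: "infinite U \<Longrightarrow> (\<And>u. u \<in> U \<Longrightarrow> poly p u = 0) \<Longrightarrow> p = 0"
  for p :: "real poly"
  by (metis (mono_tags, lifting) mem_Collect_eq poly_roots_finite rev_finite_subset subsetI)

lemma poly_poly_eq_zero_if_infinite_roots:
  fixes R :: "real poly poly"
  assumes "infinite U" "infinite V"
    and zero: "\<And>u v. u \<in> U \<Longrightarrow> v \<in> V \<Longrightarrow> poly (poly R [:v:]) u = 0"
  shows "R = 0"
proof -
  have eval: "poly (poly R [:v:]) u = poly (map_poly (\<lambda>c. poly c u) R) v" for u v :: real
    by (induction R) (simp_all add: map_poly_pCons)
  have "poly (coeff R n) u = 0" if "u \<in> U" for u n
  proof -
    have "map_poly (\<lambda>c. poly c u) R = 0"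
      using zero[OF that] assms(2) by (intro poly_eq_zero_if_infinite_roots[of V]) (simp_all add: eval)
    then show ?thesis by (metis coeff_0 coeff_map_poly poly_0)
  qed
  then have "coeff R n = 0" for n
    using assms(1) by (intro poly_eq_zero_if_infinite_roots[of U])
  then show ?thesis by (simp add: poly_eq_iff)
qed

lemma eval3_mult: "eval3 (P * Q) u0 u1 u2 = eval3 P u0 u1 u2 * eval3 Q u0 u1 u2"
  by (simp add: eval3_def)

lemma eval3_sum_vars: "eval3 (X0 + X1 + X2) u0 u1 u2 = u0 + u1 + u2"
  by (simp add: eval3_def X0_def X1_def X2_def)

text \<open>As a polynomial in \<open>X2\<close>, the linear form \<open>X0 + X1 + X2\<close> is monic of degree one with root
  \<open>- (X0 + X1)\<close>. It divides \<open>P\<close> iff the substitution of this root for \<open>X2\<close> yields the zero polynomial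
  in \<open>X0, X1\<close>; the values of the latter are those of \<open>P\<close> on the plane.\<close>

lemma dvd_if_zero_on_open:
  fixes S :: "(real^3) set"
  assumes "S \<noteq> {}" "openin (top_of_set {z. z $ 0 + z $ 1 + z $ 2 = 0}) S"
    and zero: "\<And>z. z \<in> S \<Longrightarrow> eval3 P (z $ 0) (z $ 1) (z $ 2) = 0"
  shows "(X0 + X1 + X2) dvd P"
proof -
  define c :: "real poly poly" where "c = [:[:0, -1:], -1:]"
  have factor: "X0 + X1 + X2 = [:- c, 1:]"
    by (simp add: c_def X0_def X1_def X2_def)
  have c_eval: "poly c [:v:] = [:- v, -1:]" for v by (simp add: c_def)
  \<comment> \<open>the plane as a graph over its first two coordinates\<close>
  define g :: "real \<times> real \<Rightarrow> real^3" where
    "g = (\<lambda>(u, v). \<chi> i. if i = 0 then u else if i = 1 then v else - u - v)"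
  have g: "g (u, v) $ 0 = u" "g (u, v) $ 1 = v" "g (u, v) $ 2 = - u - v" for u v
    by (simp_all add: g_def)
  have "continuous_on UNIV (\<lambda>w. if i = 0 then fst w else if i = 1 then snd w else - fst w - snd w :: real)"
    for i :: 3
    by (cases "i = 0"; cases "i = 1") (auto intro!: continuous_intros)
  then have cont: "continuous_on UNIV g"
    unfolding g_def case_prod_unfold by (rule continuous_on_vec_lambda)
  obtain T where T: "open T" "S = {z. z $ 0 + z $ 1 + z $ 2 = 0} \<inter> T"
    using assms(2) by (auto simp: openin_open)
  obtain z where z: "z \<in> S" using assms(1) by blast
  have "g (z $ 0, z $ 1) = z" using z T by (simp add: vec_three_eq_iff g)
  then have in_preimage: "(z $ 0, z $ 1) \<in> g -` T" using z T by simp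
  have "open (g -` T)" using T(1) cont by (rule open_vimage)
  then obtain U V where UV: "open U" "open V" "(z $ 0, z $ 1) \<in> U \<times> V" "U \<times> V \<subseteq> g -` T"
    using in_preimage by (rule open_prod_elim)
  have "poly P c = 0"
  proof (rule poly_poly_eq_zero_if_infinite_roots)
    show "infinite U" "infinite V" using UV(1-3) finite_imp_not_open by blast+
    fix u v assume "u \<in> U" "v \<in> V"
    then have "g (u, v) \<in> S" using UV(4) T by (auto simp: g)
    then have "eval3 P u v (- u - v) = 0" using zero g by metis
    moreover have "poly (poly (poly P c) [:v:]) u = eval3 P u v (- u - v)"
    proof -
      have "poly (poly (poly P q) [:v:]) u = poly (poly (poly P r) [:v:]) u"
        if "poly (poly q [:v:]) u = poly (poly r [:v:]) u" for q r
        using that by (induction P) simp_all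
      then show ?thesis unfolding eval3_def by (simp add: c_eval)
    qed
    ultimately show "poly (poly (poly P c) [:v:]) u = 0" by simp
  qed
  then show ?thesis unfolding factor by (simp add: poly_eq_0_iff_dvd)
qed

section \<open>Single flights with values in an open cone\<close>

text \<open>In both cases the domain contains the arc \<open>\<bar>t\<bar> < u\<close> of the time-like geodesic
  \<open>(sinh t, c cosh t, s cosh t)\<close>: along it \<open>lor (Ainv a x) x\<close> is a positive multiple of
  \<open>(sinh u)\<^sup>2 - (sinh t)\<^sup>2\<close> once the boundary condition holds at \<open>t = u\<close>. In the transverse domain
  \<open>s > 0\<close> keeps the arc in the half with \<open>x $ 2 > 0\<close>.\<close>

lemma vertical_flight:
  fixes c s u :: real
  assumes a: "a $ 0 > 0"
    and D: "D = collared_domain a \<or> D = transverse_domain a \<and> s > 0"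
    and cs: "c\<^sup>2 + s\<^sup>2 = 1" and u: "u > 0"
    and meets_cone: "(sinh u)\<^sup>2 = a $ 0 * (c\<^sup>2 / a $ 1 + s\<^sup>2 / a $ 2) * (cosh u)\<^sup>2"
  defines "X \<equiv> \<lambda>t. (\<chi> i. if i = 0 then sinh t else if i = 1 then cosh t * c else cosh t * s) :: real^3"
    and "V \<equiv> (\<chi> i. if i = 0 then cosh u else if i = 1 then - sinh u * c else - sinh u * s) :: real^3"
  shows "flight a D (X (- u)) V (2 * u) (X u)"
proof -
  let ?r = "c\<^sup>2 / a $ 1 + s\<^sup>2 / a $ 2"
  have X: "X t $ 0 = sinh t" "X t $ 1 = cosh t * c" "X t $ 2 = cosh t * s" for t
    by (simp_all add: X_def)
  have V: "V $ 0 = cosh u" "V $ 1 = - sinh u * c" "V $ 2 = - sinh u * s"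
    by (simp_all add: V_def)
  have X_hyp: "X t \<in> hyp" for t
  proof -
    have "lor (X t) (X t) = (cosh t)\<^sup>2 * (c\<^sup>2 + s\<^sup>2) - (sinh t)\<^sup>2"
      by (simp add: lor_def X algebra_simps power2_eq_square)
    then show ?thesis by (simp add: cs hyp_def cosh_square_eq)
  qed
  have cone: "lor (Ainv a (X t)) (X t) = (cosh t)\<^sup>2 * ?r - (sinh t)\<^sup>2 / a $ 0" for t
    by (simp add: lor_def Ainv_def X algebra_simps power2_eq_square)
  have cone': "lor (Ainv a (X t)) (X t) * (a $ 0 * (cosh u)\<^sup>2) = (sinh u)\<^sup>2 - (sinh t)\<^sup>2" for t
  proof -
    have "lor (Ainv a (X t)) (X t) * (a $ 0 * (cosh u)\<^sup>2)
        = (cosh t)\<^sup>2 * (a $ 0 * ?r * (cosh u)\<^sup>2) - (sinh t)\<^sup>2 * (cosh u)\<^sup>2"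
      using a unfolding cone by (simp add: field_simps)
    then show ?thesis unfolding meets_cone[symmetric] by (simp add: cosh_square_eq algebra_simps)
  qed
  have pos: "a $ 0 * (cosh u)\<^sup>2 > 0" using a by simp
  have in_D: "X t \<in> D" if "lor (Ainv a (X t)) (X t) \<ge> 0" for t
    using D X_hyp that by (auto simp: collared_domain_def transverse_domain_def X)
  have end_bdry: "X t \<in> bdry a D" if "(sinh t)\<^sup>2 = (sinh u)\<^sup>2" for t
  proof -
    have "lor (Ainv a (X t)) (X t) = 0" using cone'[of t] pos that by auto
    with in_D[of t] show ?thesis by (simp add: bdry_def)
  qed
  have inside: "X t \<in> D - bdry a D" if "\<bar>t\<bar> < u" for t
  proof -
    have "\<bar>sinh t\<bar> < \<bar>sinh u\<bar>"
      using that sinh_real_less_iff[of t u] sinh_real_less_iff[of "- t" u]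
      by (auto simp: abs_less_iff simp del: sinh_real_less_iff)
    then have "(sinh t)\<^sup>2 < (sinh u)\<^sup>2" by (metis abs_ge_zero pos2 power2_abs power_strict_mono)
    then have "lor (Ainv a (X t)) (X t) > 0"
      using cone'[of t] pos by (metis diff_gt_0_iff_gt zero_less_mult_pos2)
    with in_D[of t] show ?thesis by (simp add: bdry_def)
  qed
  have VV: "lor V V = - 1"
  proof -
    have "lor V V = (sinh u)\<^sup>2 * (c\<^sup>2 + s\<^sup>2) - (cosh u)\<^sup>2"
      by (simp add: lor_def V algebra_simps power2_eq_square)
    then show ?thesis by (simp add: cs cosh_square_eq)
  qed
  have tangent: "lor (X (- u)) V = 0"
  proof -
    have "lor (X (- u)) V = sinh u * cosh u * (1 - (c\<^sup>2 + s\<^sup>2))"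
      by (simp add: lor_def V X algebra_simps power2_eq_square)
    then show ?thesis by (simp add: cs)
  qed
  have geod: "geod (X (- u)) V t = X (t - u)" for t
    by (simp add: geod_def VV vec_three_eq_iff X V sinh_diff cosh_diff algebra_simps)
  have "X u \<noteq> - X (- u)"
  proof
    assume "X u = - X (- u)"
    then have "cosh u * c = 0" "cosh u * s = 0" by (simp_all add: vec_three_eq_iff X)
    then show False using cs by simp
  qed
  moreover have "V \<noteq> 0" using VV by (auto simp: lor_def)
  ultimately show ?thesis
    using u VV tangent unfolding flight_def tangent_hyp_def
    by (auto intro!: end_bdry inside[simplified] simp: geod)
qed

text \<open>A single flight is an orbit, and then the normalization of the representatives is no
  restriction.\<close>

lemma flight_in_successive_pairs:
  assumes fl: "flight a D p v \<tau> q" and D: "D \<subseteq> hyp" and v: "lor v v \<noteq> 0" and c: "c > 0"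
  shows "(c *\<^sub>R p, q) \<in> successive_pairs a D"
proof -
  define P where "P k = (if k = (0::nat) then p else q)" for k
  define x where "x k = (if k = (0::nat) then c *\<^sub>R p else q)" for k
  have q: "q = geod p v \<tau>" and "p \<in> bdry a D" and v_tan: "lor p v = 0"
    using fl unfolding flight_def tangent_hyp_def by blast+
  then have "lor p p = 1" using D by (auto simp: bdry_def hyp_def)
  then have "wedge_sq p v \<noteq> 0" using wedge_sq_tangent v v_tan by simp
  then have "wedge_sq (c *\<^sub>R p) q \<noteq> 0"
    using bivector_form_chord[OF bivector_form_wedge_sq, of c p 1 v \<tau>]
      flight_geod_sin_nonzero[OF fl] c by (simp add: q)
  moreover have "billiard_orbit a D 1 P (\<lambda>_. v) (\<lambda>_. \<tau>)"
    using fl by (auto simp: billiard_orbit_def P_def one_enat_def)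
  moreover have "normalized_rep 1 P (wedge_sq (c *\<^sub>R p) q) x"
    using c by (auto simp: normalized_rep_def one_enat_def P_def x_def intro: exI[of _ 1])
  moreover have "(c *\<^sub>R p, q) = (x 0, x (Suc 0))" "enat 0 < 1"
    by (simp_all add: x_def one_enat_def)
  ultimately show ?thesis unfolding successive_pairs_def by blast
qed

text \<open>The values of \<open>(F a 0, F a 1, F a 2)\<close> on positive multiples of the end points of vertical
  flights with \<open>c, s \<noteq> 0\<close>. There \<open>z $ 1 * (a $ 1 - a $ 0)\<close> and \<open>z $ 2 * (a $ 2 - a $ 0)\<close> are
  \<open>- c\<^sup>2\<close> and \<open>- s\<^sup>2\<close> up to a common positive factor; the last inequality says that the cone condition \<open>lor (Ainv a x) x > 0\<close>
  holds in the middle of the arc, at \<open>(0, c, s)\<close>.\<close>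

definition vertical_values :: "real^3 \<Rightarrow> (real^3) set" where
  "vertical_values a = {z. z $ 0 + z $ 1 + z $ 2 = 0 \<and>
     z $ 1 * (a $ 1 - a $ 0) < 0 \<and> z $ 2 * (a $ 2 - a $ 0) < 0 \<and>
     z $ 1 * (a $ 1 - a $ 0) / a $ 1 + z $ 2 * (a $ 2 - a $ 0) / a $ 2 < 0}"

lemma vertical_values_open:
  "openin (top_of_set {z. z $ 0 + z $ 1 + z $ 2 = 0}) (vertical_values a)"
proof -
  have "open {z :: real^3. z $ 1 * (a $ 1 - a $ 0) < 0 \<and> z $ 2 * (a $ 2 - a $ 0) < 0 \<and>
     z $ 1 * (a $ 1 - a $ 0) / a $ 1 + z $ 2 * (a $ 2 - a $ 0) / a $ 2 < 0}"
    unfolding divide_inverse by (intro open_Collect_conj open_Collect_less continuous_intros)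
  moreover have "vertical_values a = {z. z $ 0 + z $ 1 + z $ 2 = 0} \<inter>
     {z. z $ 1 * (a $ 1 - a $ 0) < 0 \<and> z $ 2 * (a $ 2 - a $ 0) < 0 \<and>
     z $ 1 * (a $ 1 - a $ 0) / a $ 1 + z $ 2 * (a $ 2 - a $ 0) / a $ 2 < 0}"
    by (auto simp: vertical_values_def)
  ultimately show ?thesis by (simp add: openin_open_Int)
qed

lemma vertical_values_nonempty:
  assumes "0 < a $ 0" "a $ 0 < a $ 2" "a $ 1 \<noteq> 0" "a $ 1 \<noteq> a $ 0"
  shows "vertical_values a \<noteq> {}"
proof -
  \<comment> \<open>\<open>\<epsilon>\<close> is the ratio \<open>c\<^sup>2 : s\<^sup>2\<close>; when \<open>a $ 1 < 0\<close> the middle of the arc satisfies the cone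
    condition only if this ratio is small\<close>
  obtain \<epsilon> where \<epsilon>: "\<epsilon> > 0" "\<epsilon> * \<bar>a $ 2 / a $ 1\<bar> < 1"
    using assms by (intro that[of "\<bar>a $ 1 / a $ 2\<bar> / 2"]) (auto simp: abs_divide)
  define z :: "real^3" where "z = (\<chi> i. if i = 1 then - \<epsilon> / (a $ 1 - a $ 0)
    else if i = 2 then - 1 / (a $ 2 - a $ 0) else \<epsilon> / (a $ 1 - a $ 0) + 1 / (a $ 2 - a $ 0))"
  have z: "z $ 1 * (a $ 1 - a $ 0) = - \<epsilon>" "z $ 2 * (a $ 2 - a $ 0) = - 1"
    "z $ 0 + z $ 1 + z $ 2 = 0"
    using assms by (simp_all add: z_def)
  have "\<bar>\<epsilon> * (a $ 2 / a $ 1)\<bar> < 1"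
    using \<epsilon> by (simp add: abs_mult)
  then have "- 1 < \<epsilon> * (a $ 2 / a $ 1)" by linarith
  then have "1 / a $ 2 * (- (\<epsilon> * (a $ 2 / a $ 1)) - 1) < 0"
    using assms by (intro mult_pos_neg) auto
  then have "- \<epsilon> / a $ 1 - 1 / a $ 2 < 0"
    using assms by (simp add: right_diff_distrib)
  then have "z \<in> vertical_values a" using \<epsilon>(1) by (simp add: vertical_values_def z)
  then show ?thesis by blast
qed

lemma vertical_values_attained:
  assumes a: "0 < a $ 0" "a $ 0 < a $ 2" "a $ 1 < 0 \<or> a $ 0 < a $ 1"
    and D: "D = collared_domain a \<or> D = transverse_domain a" and D_hyp: "D \<subseteq> hyp"
    and z: "z \<in> vertical_values a"
  shows "\<exists>(x, y) \<in> successive_pairs a D. z = (\<chi> j. F a j x y)"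
proof -
  define C where "C = - z $ 1 * (a $ 1 - a $ 0)"
  define E where "E = - z $ 2 * (a $ 2 - a $ 0)"
  have CE: "C > 0" "E > 0" "C / a $ 1 + E / a $ 2 > 0" and z_sum: "z $ 0 + z $ 1 + z $ 2 = 0"
    using z by (auto simp: vertical_values_def C_def E_def)
  define c where "c = sqrt (C / (C + E))"
  define s where "s = sqrt (E / (C + E))"
  have c2: "c\<^sup>2 = C / (C + E)" and s2: "s\<^sup>2 = E / (C + E)" and s_pos: "s > 0"
    using CE by (simp_all add: c_def s_def)
  have cs: "c\<^sup>2 + s\<^sup>2 = 1"
    using CE by (simp add: c2 s2 add_divide_distrib[symmetric])
  \<comment> \<open>\<open>q\<close> is the value of \<open>tanh\<^sup>2 u\<close> at which the geodesic meets the cone\<close>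
  define q where "q = a $ 0 * (c\<^sup>2 / a $ 1 + s\<^sup>2 / a $ 2)"
  have "q = a $ 0 * (C / a $ 1 + E / a $ 2) / (C + E)"
    using CE by (simp add: q_def c2 s2 add_divide_distrib ring_distribs mult.commute)
  then have q_pos: "q > 0" using a CE by simp
  have "q = c\<^sup>2 * (a $ 0 / a $ 1) + s\<^sup>2 * (a $ 0 / a $ 2)"
    by (simp add: q_def algebra_simps)
  moreover have "a $ 0 / a $ 1 < 1" "a $ 0 / a $ 2 < 1"
    using a by (auto simp: divide_simps)
  then have "c\<^sup>2 * (a $ 0 / a $ 1) + s\<^sup>2 * (a $ 0 / a $ 2) < c\<^sup>2 * 1 + s\<^sup>2 * 1"
    using CE by (intro add_strict_mono mult_strict_left_mono) (simp_all add: c2 s2)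
  ultimately have q_less: "q < 1" using cs by simp
  define u where "u = arsinh (sqrt (q / (1 - q)))"
  have sinh_u: "(sinh u)\<^sup>2 = q / (1 - q)"
    using q_pos q_less by (simp add: u_def)
  have cosh_u: "(cosh u)\<^sup>2 = 1 / (1 - q)"
    using q_less by (simp add: cosh_square_eq sinh_u field_simps)
  have u: "u > 0" using q_pos q_less by (simp add: u_def)
  define X :: "real \<Rightarrow> real^3" where
    "X t = (\<chi> i. if i = 0 then sinh t else if i = 1 then cosh t * c else cosh t * s)" for t
  define V :: "real^3" where
    "V = (\<chi> i. if i = 0 then cosh u else if i = 1 then - sinh u * c else - sinh u * s)"
  have X: "X t $ 0 = sinh t" "X t $ 1 = cosh t * c" "X t $ 2 = cosh t * s" for t
    by (simp_all add: X_def)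
  have fl: "flight a D (X (- u)) V (2 * u) (X u)"
    unfolding X_def V_def
    using a D s_pos cs u sinh_u cosh_u by (intro vertical_flight) (auto simp flip: q_def)
  have "lor V V = (sinh u)\<^sup>2 * (c\<^sup>2 + s\<^sup>2) - (cosh u)\<^sup>2"
    by (simp add: V_def lor_def algebra_simps power2_eq_square)
  then have "lor V V = - 1" by (simp add: cs cosh_square_eq)
  \<comment> \<open>the coordinates \<open>0, 1\<close> and \<open>0, 2\<close> of \<open>X (- u) \<and> X u\<close> are \<open>2 sinh u cosh u\<close> times \<open>c\<close> and \<open>s\<close>, up to
    sign; \<open>\<mu>\<close> turns their squares into \<open>C\<close> and \<open>E\<close>\<close>
  define \<mu> where "\<mu> = sqrt (C + E) / (2 * sinh u * cosh u)"
  have \<mu>: "\<mu> > 0" using CE u by (simp add: \<mu>_def)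
  have \<mu>2: "\<mu>\<^sup>2 * (2 * sinh u * cosh u * w)\<^sup>2 = (C + E) * w\<^sup>2" for w
    using CE u by (simp add: \<mu>_def power_divide power_mult_distrib)
  have U: "UNIV - {1} = {0, 2 :: 3}" "UNIV - {2} = {0, 1 :: 3}"
    using all_three[of "\<lambda>i. i = 0 \<or> i = 1 \<or> i = 2"] by auto
  have scale: "F a j (\<mu> *\<^sub>R X (- u)) (X u) = \<mu>\<^sup>2 * F a j (X (- u)) (X u)" for j
    using bivector_formD[OF bivector_form_F, of a j \<mu> "X (- u)" 0 "X u" 0 1] by simp
  have "F a 1 (X (- u)) (X u) = - (2 * sinh u * cosh u * c)\<^sup>2 / (a $ 1 - a $ 0)"
    by (simp add: F_def U J_def X power2_eq_square algebra_simps)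
  then have F1: "F a 1 (\<mu> *\<^sub>R X (- u)) (X u) = z $ 1"
    unfolding scale using \<mu>2[of c] CE a by (auto simp: c2 C_def)
  have "F a 2 (X (- u)) (X u) = - (2 * sinh u * cosh u * s)\<^sup>2 / (a $ 2 - a $ 0)"
    by (simp add: F_def U J_def X power2_eq_square algebra_simps)
  then have F2: "F a 2 (\<mu> *\<^sub>R X (- u)) (X u) = z $ 2"
    unfolding scale using \<mu>2[of s] CE a by (auto simp: s2 E_def)
  have "F a 0 (\<mu> *\<^sub>R X (- u)) (X u) = z $ 0"
    using F_sum_zero[of a "\<mu> *\<^sub>R X (- u)" "X u"] F1 F2 z_sum by linarith
  then have "z = (\<chi> j. F a j (\<mu> *\<^sub>R X (- u)) (X u))"
    by (simp add: vec_three_eq_iff F1 F2)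
  moreover have "(\<mu> *\<^sub>R X (- u), X u) \<in> successive_pairs a D"
    using fl D_hyp \<open>lor V V = - 1\<close> \<mu> by (intro flight_in_successive_pairs) auto
  ultimately show ?thesis by blast
qed

theorem corollary4p2:
  fixes a :: "real^3" and D :: "(real^3) set"
  assumes "collared a \<and> D = collared_domain a \<or> transverse a \<and> D = transverse_domain a"
  shows
    \<comment> \<open>each \<open>F a j\<close> is an integral\<close>
    "(\<forall>N p v \<tau> \<kappa> x. billiard_orbit a D N p v \<tau> \<and> normalized_rep N p \<kappa> x \<and> \<kappa> \<noteq> 0 \<longrightarrow>
        (\<forall>j k l. enat k < N \<and> enat l < N \<longrightarrow> F a j (x k) (x (Suc k)) = F a j (x l) (x (Suc l))))
     \<and>
     (\<forall>N p v \<tau>. billiard_orbit a D N p v \<tau> \<longrightarrow>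
        (\<exists>\<kappa> x. normalized_rep N p \<kappa> x \<and>
          (\<forall>j k l. enat k < N \<and> enat l < N \<longrightarrow> F a j (x k) (x (Suc k)) = F a j (x l) (x (Suc l)))))
     \<and>
     \<comment> \<open>the relation\<close>
     (\<forall>x y. F a 0 x y + F a 1 x y + F a 2 x y = 0)
     \<and>
     \<comment> \<open>its uniqueness: every polynomial relation is a multiple of it, and there is no further
       functional dependence, as the values fill an open part of the plane that it defines\<close>
     (\<forall>P. (\<forall>(x, y) \<in> successive_pairs a D. eval3 P (F a 0 x y) (F a 1 x y) (F a 2 x y) = 0)
        \<longleftrightarrow> (X0 + X1 + X2) dvd P)
     \<and>
     (\<exists>S :: (real^3) set. S \<noteq> {} \<and>
        openin (top_of_set {z. z $ 0 + z $ 1 + z $ 2 = 0}) S \<and>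
        S \<subseteq> (\<lambda>(x, y). \<chi> j. F a j x y) ` successive_pairs a D)"
proof -
  have a: "0 < a $ 0" "a $ 0 < a $ 2" "a $ 1 < 0 \<or> a $ 0 < a $ 1" "a $ 1 \<noteq> a $ 2"
    and D: "D = collared_domain a \<or> D = transverse_domain a"
    using assms by (auto simp: collared_def transverse_def)
  have D_hyp: "D \<subseteq> hyp"
    using D by (auto simp: collared_domain_def transverse_domain_def)
  have a_nz: "\<forall>i. a $ i \<noteq> 0" and a_dist: "\<forall>i j. i \<noteq> j \<longrightarrow> a $ i \<noteq> a $ j"
    unfolding all_three using a by auto
  interpret billiard a D
    using a_nz a_dist D_hyp by unfold_locales blast+
  let ?S = "vertical_values a"
  have S: "?S \<noteq> {}" "openin (top_of_set {z. z $ 0 + z $ 1 + z $ 2 = 0}) ?S"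
    using vertical_values_nonempty[of a] vertical_values_open a by auto
  have attained: "\<exists>(x, y) \<in> successive_pairs a D. z = (\<chi> j. F a j x y)" if "z \<in> ?S" for z
    using vertical_values_attained[OF a(1-3) D D_hyp that] .
  have relations: "(\<forall>(x, y) \<in> successive_pairs a D. eval3 P (F a 0 x y) (F a 1 x y) (F a 2 x y) = 0)
      \<longleftrightarrow> (X0 + X1 + X2) dvd P" for P
  proof
    assume zero: "\<forall>(x, y) \<in> successive_pairs a D. eval3 P (F a 0 x y) (F a 1 x y) (F a 2 x y) = 0"
    show "(X0 + X1 + X2) dvd P"
    proof (rule dvd_if_zero_on_open[OF S])
      fix z assume "z \<in> ?S"
      then show "eval3 P (z $ 0) (z $ 1) (z $ 2) = 0" using attained zero by fastforce
    qed
  next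
    assume "(X0 + X1 + X2) dvd P"
    then show "\<forall>(x, y) \<in> successive_pairs a D. eval3 P (F a 0 x y) (F a 1 x y) (F a 2 x y) = 0"
      by (auto simp: dvd_def eval3_mult eval3_sum_vars F_sum_zero)
  qed
  show ?thesis
  proof (intro conjI allI impI)
    fix N p v \<tau> \<kappa> x j k l
    assume "billiard_orbit a D N p v \<tau> \<and> normalized_rep N p \<kappa> x \<and> \<kappa> \<noteq> 0"
      and "enat k < N \<and> enat l < N"
    then show "F a j (x k) (x (Suc k)) = F a j (x l) (x (Suc l))"
      using integral_if_normalized by metis
  next
    fix N p v \<tau>
    assume "billiard_orbit a D N p v \<tau>"
    then show "\<exists>\<kappa> x. normalized_rep N p \<kappa> x \<and>
        (\<forall>j k l. enat k < N \<and> enat l < N \<longrightarrow> F a j (x k) (x (Suc k)) = F a j (x l) (x (Suc l)))"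
      using exists_normalization by metis
  next
    show "\<exists>S :: (real^3) set. S \<noteq> {} \<and>
        openin (top_of_set {z. z $ 0 + z $ 1 + z $ 2 = 0}) S \<and>
        S \<subseteq> (\<lambda>(x, y). \<chi> j. F a j x y) ` successive_pairs a D"
      using S attained by (intro exI[of _ ?S]) fastforce
  qed (use F_sum_zero relations in auto)
qed

end
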